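(* Let $n$ and $\ell$ be positive integers, let $D$ be a condition on families of subsets of $[n]$, and let $\mathcal{F}\subset 2^{[n]}$ be a family satisfying $D$. Then $\mathcal{F}$ contains at most $S_\ell(n,D)$ $\ell$-chains, i.e. the number of $\ell$-chains $\mathcal{G}_\ell$ with $\mathcal{G}_\ell\subset\mathcal{F}$ is at most $S_\ell(n,D)$.
   Context: $[n]=\{1,2,\dots,n\}$ and $2^{[n]}$ is the family of all subsets of $[n]$. A condition $D$ is an arbitrary property (predicate) that a family $\mathcal{F}\subset 2^{[n]}$ may or may not satisfy. A full chain is a family $\mathcal{C}=\{A_0,A_1,\dots,A_n\}$ of sets $A_i\in 2^{[n]}$ with $|A_i|=i$ for all $i$ and $A_i\subset A_{i+1}$ for every $0\le i<n$. Let $\mathfrak{C}_n$ denote the set of all $n!$ full chains in $2^{[n]}$. An $\ell$-chain is a family $\mathcal{G}_\ell=\{G_1,\dots,G_\ell\}$ of $\ell$ distinct subsets of $[n]$ with $G_1\subset G_2\subset\dots\subset G_\ell$. For a family $\mathcal{F}\subset 2^{[n]}$ and an $\ell$-chain $\mathcal{G}_\ell=\{G_1\subset\dots\subset G_\ell\}\subset 2^{[n]}$, let $$\omega_{\mathcal{F}}(\mathcal{G}_\ell)=\binom{n}{|G_\ell|}\binom{|G_\ell|}{|G_{\ell-1}|}\cdots\binom{|G_2|}{|G_1|}$$ if $\mathcal{G}_\ell\subset\mathcal{F}$, and $\omega_{\mathcal{F}}(\mathcal{G}_\ell)=0$ otherwise. Define $$s_\ell(\mathcal{F})=\max_{\mathcal{C}\in\mathfrak{C}_n}\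 \sum_{\mathcal{G}_\ell\subset\mathcal{C}}\omega_{\mathcal{F}}(\mathcal{G}_\ell),$$ where the sum is over all $\ell$-chains $\mathcal{G}_\ell$ contained in $\mathcal{C}$, and $$S_\ell(n,D)=\max\{s_\ell(\mathcal{F}') : \mathcal{F}'\subset 2^{[n]},\ \mathcal{F}'\text{ satisfies } D\}.$$ *)

theory Defs
  imports Complex_Main
begin

definition full_chains :: "nat \<Rightarrow> nat set set set" where
  "full_chains n = {\<C>. \<exists>A :: nat \<Rightarrow> nat set. \<C> = A ` {0..n} \<and>
     (\<forall>i\<le>n. A i \<subseteq> {1..n} \<and> card (A i) = i) \<and> (\<forall>i<n. A i \<subset> A (Suc i))}"

text \<open>A chain is a family, i.e. an unordered set of sets; the list below is its increasing
  enumeration \<open>G\<^sub>1 \<subset> \<dots> \<subset> G\<^sub>l\<close> (indexed from \<open>0\<close>).\<close>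

definition increasing_enum :: "'a set list \<Rightarrow> 'a set set \<Rightarrow> bool" where
  "increasing_enum Gs \<G> \<longleftrightarrow> sorted_wrt (\<subset>) Gs \<and> set Gs = \<G>"

definition l_chains :: "nat \<Rightarrow> nat \<Rightarrow> nat set set set" where
  "l_chains n l = {\<G>. \<G> \<subseteq> Pow {1..n} \<and> (\<exists>Gs. increasing_enum Gs \<G> \<and> length Gs = l)}"

definition chain_list :: "'a set set \<Rightarrow> 'a set list" where
  "chain_list \<G> = (THE Gs. increasing_enum Gs \<G>)"

lemma increasing_enum_unique:
  assumes "increasing_enum Gs \<G>" "increasing_enum Hs \<G>"
  shows "Gs = Hs"
proof -
  have "sorted_wrt (\<subset>) Gs \<Longrightarrow> sorted_wrt (\<subset>) Hs \<Longrightarrow> set Gs = set Hs \<Longrightarrow> Gs = Hs"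
  proof (induction Gs arbitrary: Hs)
    case Nil
    then show ?case by simp
  next
    case (Cons a Gs)
    then obtain b Hs' where Hs: "Hs = b # Hs'" by (cases Hs) auto
    have ab: "a = b"
    proof (rule ccontr)
      assume "a \<noteq> b"
      then have "b \<in> set Gs" "a \<in> set Hs'" using Cons.prems Hs by auto
      then show False using Cons.prems Hs by auto
    qed
    have "a \<notin> set Gs" "a \<notin> set Hs'" using Cons.prems Hs ab by auto
    then have "set Gs = set Hs'" using Cons.prems Hs ab by auto
    then show ?case using Cons.IH[of Hs'] Cons.prems Hs ab by simp
  qed
  then show ?thesis using assms unfolding increasing_enum_def by simp
qed

lemma chain_list_eq: "increasing_enum Gs \<G> \<Longrightarrow> chain_list \<G> = Gs"
  unfolding chain_list_def by (blast intro: increasing_enum_unique)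

text \<open>The weight is meant for nonempty chains contained in the power set of \<open>{1..n}\<close>.\<close>

definition chain_weight :: "nat \<Rightarrow> nat set set \<Rightarrow> nat set set \<Rightarrow> nat" where
  "chain_weight n \<F> \<G> =
     (if \<G> \<subseteq> \<F>
      then let Gs = chain_list \<G> in
        (n choose card (last Gs)) *
        (\<Prod>i<length Gs - 1. card (Gs ! Suc i) choose card (Gs ! i))
      else 0)"

definition max_chain_weight :: "nat \<Rightarrow> nat \<Rightarrow> nat set set \<Rightarrow> nat" where
  "max_chain_weight n l \<F> =
     Max ((\<lambda>\<C>. \<Sum>\<G> \<in> {\<G> \<in> l_chains n l. \<G> \<subseteq> \<C>}. chain_weight n \<F> \<G>) ` full_chains n)"

lemma finite_full_chains: "finite (full_chains n)"
  by (rule finite_subset[of _ "Pow (Pow {1..n})"]) (auto simp: full_chains_def)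

lemma full_chains_nonempty: "full_chains n \<noteq> {}"
proof -
  have "(\<lambda>i. {1..i}) ` {0..n} \<in> full_chains n"
    unfolding full_chains_def by (auto intro!: exI[of _ "\<lambda>i::nat. {1..i}"])
  then show ?thesis by blast
qed

lemma finite_l_chains: "finite (l_chains n l)"
  by (rule finite_subset[of _ "Pow (Pow {1..n})"]) (auto simp: l_chains_def)

text \<open>The set under the maximum is always finite; it is nonempty as soon as some family in the
  power set of \<open>{1..n}\<close> satisfies \<open>D\<close>.\<close>

definition S_bound :: "nat \<Rightarrow> nat \<Rightarrow> (nat set set \<Rightarrow> bool) \<Rightarrow> nat" where
  "S_bound l n D = Max {max_chain_weight n l \<F>' | \<F>'. \<F>' \<subseteq> Pow {1..n} \<and> D \<F>'}"

end

(* Averaging over all n! orderings xs of {1..n}, whose sets of initial segments are full chains.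
   An ordering whose initial segments include a given chain with top A consists of such an ordering
   of A for the rest of the chain followed by an arbitrary ordering of the complement of A. By
   induction, the number of these orderings times the weight of the chain is n!. Summing over the
   chains inside the family and exchanging the sums, the average over xs of the weight sum is
   exactly the number of chains, so the maximum is at least that number. *)
theory Submission
  imports Defs "HOL-Combinatorics.Multiset_Permutations" "HOL-Library.Sublist"
begin

definition prefix_sets :: "'a list \<Rightarrow> 'a set set" where
  "prefix_sets xs = {set ys | ys. prefix ys xs}"

lemma prefix_sets_conv_take: "prefix_sets xs = (\<lambda>i. set (take i xs)) ` {0..length xs}"
proof (intro equalityI subsetI)
  fix A assume "A \<in> prefix_sets xs"
  then obtain ys where "A = set ys" "prefix ys xs" unfolding prefix_sets_def by blast
  then show "A \<in> (\<lambda>i. set (take i xs)) ` {0..length xs}"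
    by (auto simp: prefix_def intro!: image_eqI[of _ _ "length ys"])
qed (auto simp: prefix_sets_def intro: take_is_prefix)

text \<open>An initial segment that reaches into \<open>zs\<close> contains all of
  \<open>set ys\<close>, so it can only equal \<open>B\<close> when \<open>B = set ys\<close>, which
  is already an initial segment of \<open>ys\<close>.\<close>

lemma prefix_sets_append_iff:
  assumes "distinct (ys @ zs)" and "B \<subseteq> set ys"
  shows "B \<in> prefix_sets (ys @ zs) \<longleftrightarrow> B \<in> prefix_sets ys"
proof
  assume "B \<in> prefix_sets (ys @ zs)"
  then consider us where "B = set us" "prefix us ys"
    | us where "B = set ys \<union> set us" "prefix us zs"
    by (auto simp: prefix_sets_def prefix_append)
  then show "B \<in> prefix_sets ys"
  proof cases
    case 2
    with assms(2) have "B = set ys" by blast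
    then show ?thesis by (auto simp: prefix_sets_def)
  qed (auto simp: prefix_sets_def)
qed (auto simp: prefix_sets_def intro: prefix_prefix)

lemma prefix_sets_full_chain:
  assumes "xs \<in> permutations_of_set {1..n}"
  shows "prefix_sets xs \<in> full_chains n"
proof -
  have xs: "distinct xs" "set xs = {1..n}" "length xs = n"
    using assms length_finite_permutations_of_set[OF assms]
    by (auto dest: permutations_of_setD)
  have "set (take i xs) \<subset> set (take (Suc i) xs)" if "i < n" for i
  proof -
    have "xs ! i \<notin> set (take i xs)"
      using that xs by (auto simp: in_set_conv_nth nth_eq_iff_index_eq)
    then show ?thesis using that xs by (auto simp: take_Suc_conv_app_nth)
  qed
  moreover have "set (take i xs) \<subseteq> {1..n}" for i
    using set_take_subset[of i xs] xs(2) by blast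
  moreover have "card (set (take i xs)) = i" if "i \<le> n" for i
    using that xs by (simp add: distinct_card)
  ultimately show ?thesis
    unfolding full_chains_def prefix_sets_conv_take xs(3) by blast
qed

text \<open>The ground set is a parameter because the induction replaces it by the top set of the
  chain.\<close>

definition orderings_through :: "'a set \<Rightarrow> 'a set set \<Rightarrow> 'a list set" where
  "orderings_through X \<G> = {xs \<in> permutations_of_set X. \<G> \<subseteq> prefix_sets xs}"

text \<open>Cutting an ordering of \<open>X\<close> right after the elements of \<open>A\<close> is
  a bijection onto pairs of orderings of \<open>A\<close> and of \<open>X - A\<close>; members of
  \<open>\<G>\<close> lie inside \<open>A\<close>, so only the first half has to pass through
  them.\<close>

lemma card_orderings_through_insert:
  assumes "finite X" "A \<subseteq> X" "\<forall>B\<in>\<G>. B \<subseteq> A"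
  shows "card (orderings_through X (insert A \<G>))
    = card (orderings_through A \<G>) * fact (card X - card A)"
proof -
  let ?S = "orderings_through A \<G> \<times> permutations_of_set (X - A)"
  have "bij_betw (\<lambda>(ys, zs). ys @ zs) ?S (orderings_through X (insert A \<G>))"
  proof (rule bij_betw_imageI)
    \<comment> \<open>All first halves have the same length, so the cut point is determined by the
      concatenation.\<close>
    have "length ys = card A" if "ys \<in> orderings_through A \<G>" for ys
      using that length_finite_permutations_of_set by (auto simp: orderings_through_def)
    then show "inj_on (\<lambda>(ys, zs). ys @ zs) ?S" by (auto simp: inj_on_def)
    show "(\<lambda>(ys, zs). ys @ zs) ` ?S = orderings_through X (insert A \<G>)"
    proof (intro equalityI subsetI)
      fix xs assume "xs \<in> (\<lambda>(ys, zs). ys @ zs) ` ?S"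
      then obtain ys zs where xs: "xs = ys @ zs"
        and ys: "set ys = A" "distinct ys" "\<G> \<subseteq> prefix_sets ys"
        and zs: "set zs = X - A" "distinct zs"
        by (auto simp: orderings_through_def permutations_of_set_def)
      have d: "distinct (ys @ zs)" using ys zs by auto
      have "A \<in> prefix_sets (ys @ zs)" using ys(1) by (auto simp: prefix_sets_def)
      moreover have "\<G> \<subseteq> prefix_sets (ys @ zs)"
        using ys assms(3) prefix_sets_append_iff[OF d] by blast
      ultimately show "xs \<in> orderings_through X (insert A \<G>)"
        using xs ys(1) zs(1) d assms(2)
        by (auto simp: orderings_through_def permutations_of_set_def)
    next
      fix xs assume "xs \<in> orderings_through X (insert A \<G>)"
      then have xs: "set xs = X" "distinct xs" "A \<in> prefix_sets xs" "\<G> \<subseteq> prefix_sets xs"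
        by (auto simp: orderings_through_def permutations_of_set_def)
      then obtain ys zs where split: "xs = ys @ zs" "A = set ys"
        by (auto simp: prefix_sets_def prefix_def)
      have "\<G> \<subseteq> prefix_sets ys"
        using xs split assms(3) prefix_sets_append_iff[of ys zs] by blast
      then have "(ys, zs) \<in> ?S"
        using xs split by (auto simp: orderings_through_def permutations_of_set_def)
      then show "xs \<in> (\<lambda>(ys, zs). ys @ zs) ` ?S" using split by force
    qed
  qed
  then have "card (orderings_through X (insert A \<G>)) = card ?S"
    by (simp add: bij_betw_same_card)
  moreover have "card (permutations_of_set (X - A)) = fact (card X - card A)"
    using assms by (simp add: card_Diff_subset finite_subset)
  ultimately show ?thesis by (simp add: card_cartesian_product)
qed

text \<open>For a nonempty chain in an \<open>m\<close>-element set this is the multinomial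
  coefficient of the successive differences. Unlike in \<open>chain_weight\<close>, the chain is a
  list and \<open>m\<close> can vary in the induction.\<close>

definition multinomial_weight :: "nat \<Rightarrow> 'a set list \<Rightarrow> nat" where
  "multinomial_weight m Gs = (m choose card (last Gs)) *
     (\<Prod>i<length Gs - 1. card (Gs ! Suc i) choose card (Gs ! i))"

lemma multinomial_weight_snoc:
  assumes "Gs \<noteq> []"
  shows "multinomial_weight m (Gs @ [A]) = (m choose card A) * multinomial_weight (card A) Gs"
proof -
  obtain k where k: "length Gs = Suc k" using assms by (cases Gs) auto
  have "(\<Prod>i<k. card ((Gs @ [A]) ! Suc i) choose card ((Gs @ [A]) ! i))
      = (\<Prod>i<k. card (Gs ! Suc i) choose card (Gs ! i))"
    by (rule prod.cong) (auto simp: nth_append k)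
  \<comment> \<open>The last factor of the product thus becomes the leading binomial of the weight
    of \<open>Gs\<close> with \<open>m = card A\<close>.\<close>
  moreover have "last Gs = Gs ! k" using k by (simp add: last_conv_nth[OF assms])
  ultimately show ?thesis by (simp add: multinomial_weight_def k nth_append)
qed

text \<open>Removing the top set \<open>A\<close> shrinks the ground set to \<open>A\<close>. The
  factor gained by the weight, \<open>card X choose card A\<close>, and the one gained by the count,
  \<open>fact (card X - card A)\<close>, turn \<open>fact (card A)\<close> into
  \<open>fact (card X)\<close>.\<close>

lemma multinomial_weight_times_orderings:
  assumes "finite X" "Gs \<noteq> []" "sorted_wrt (\<subset>) Gs" "\<forall>G\<in>set Gs. G \<subseteq> X"
  shows "multinomial_weight (card X) Gs * card (orderings_through X (set Gs)) = fact (card X)"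
  using assms
proof (induction Gs arbitrary: X rule: rev_induct)
  case (snoc A Gs)
  have AX: "A \<subseteq> X" and fin: "finite A" and le: "card A \<le> card X"
    using snoc.prems by (auto intro: finite_subset card_mono)
  have sub: "\<forall>B\<in>set Gs. B \<subseteq> A" using snoc.prems by (auto simp: sorted_wrt_append)
  have ord: "card (orderings_through X (set (Gs @ [A])))
      = card (orderings_through A (set Gs)) * fact (card X - card A)"
    using card_orderings_through_insert[OF snoc.prems(1) AX sub] by simp
  have binom: "fact (card A) * fact (card X - card A) * (card X choose card A) = fact (card X)"
    using binomial_fact_lemma[OF le] .
  show ?case
  proof (cases "Gs = []")
    \<comment> \<open>A single set is the real base case, as the weight uses \<open>last\<close>;
      every ordering of \<open>A\<close> then counts.\<close>
    case True
    then have "card (orderings_through A (set Gs)) = fact (card A)"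
      using fin by (simp add: orderings_through_def)
    then show ?thesis
      using ord binom True by (simp add: multinomial_weight_def mult_ac)
  next
    case False
    have IH: "multinomial_weight (card A) Gs * card (orderings_through A (set Gs)) = fact (card A)"
      using snoc.IH[OF fin False _ sub] snoc.prems by (simp add: sorted_wrt_append)
    have "multinomial_weight (card X) (Gs @ [A]) * card (orderings_through X (set (Gs @ [A])))
       = (multinomial_weight (card A) Gs * card (orderings_through A (set Gs)))
         * fact (card X - card A) * (card X choose card A)"
      unfolding ord multinomial_weight_snoc[OF False] by (simp add: mult_ac)
    then show ?thesis using IH binom by simp
  qed
qed simp

lemma chain_weight_times_orderings:
  assumes "l \<ge> 1" "\<G> \<in> l_chains n l" "\<G> \<subseteq> \<F>"
  shows "chain_weight n \<F> \<G> * card (orderings_through {1..n} \<G>) = fact n"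
proof -
  obtain Gs where Gs: "increasing_enum Gs \<G>" "length Gs = l" and sub: "\<G> \<subseteq> Pow {1..n}"
    using assms(2) by (auto simp: l_chains_def)
  have "chain_weight n \<F> \<G> = multinomial_weight n Gs"
    using assms(3) chain_list_eq[OF Gs(1)] by (simp add: chain_weight_def multinomial_weight_def)
  moreover have "multinomial_weight (card {1..n}) Gs * card (orderings_through {1..n} (set Gs))
      = fact (card {1..n})"
    using Gs sub assms(1)
    by (intro multinomial_weight_times_orderings) (auto simp: increasing_enum_def)
  ultimately show ?thesis using Gs(1) by (simp add: increasing_enum_def)
qed

lemma card_chains_le_max_chain_weight:
  assumes "l \<ge> 1"
  shows "card {\<G> \<in> l_chains n l. \<G> \<subseteq> \<F>} \<le> max_chain_weight n l \<F>"
proof -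
  let ?P = "permutations_of_set {1..n}"
  let ?L = "l_chains n l"
  let ?w = "chain_weight n \<F>"
  have "card {\<G> \<in> ?L. \<G> \<subseteq> \<F>} * fact n = (\<Sum>\<G>\<in>{\<G> \<in> ?L. \<G> \<subseteq> \<F>}. fact n)"
    by simp
  also have "\<dots> = (\<Sum>\<G>\<in>{\<G> \<in> ?L. \<G> \<subseteq> \<F>}. ?w \<G> * card (orderings_through {1..n} \<G>))"
    \<comment> \<open>Keeping \<open>1\<close> unfolded would spoil the match: the rewrite rule
      speaks of \<open>{1..n}\<close>, not \<open>{Suc 0..n}\<close>.\<close>
    by (rule sum.cong) (simp_all add: chain_weight_times_orderings[OF assms] del: One_nat_def)
  \<comment> \<open>Chains not inside \<open>\<F>\<close> have weight 0, so the sum may run over all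
    chains.\<close>
  also have "\<dots> = (\<Sum>\<G>\<in>?L. ?w \<G> * card (orderings_through {1..n} \<G>))"
    by (rule sum.mono_neutral_left) (auto simp: finite_l_chains chain_weight_def)
  also have "\<dots> = (\<Sum>\<G>\<in>?L. \<Sum>xs\<in>{xs \<in> ?P. \<G> \<subseteq> prefix_sets xs}. ?w \<G>)"
    by (simp add: orderings_through_def mult.commute)
  also have "\<dots> = (\<Sum>xs\<in>?P. \<Sum>\<G>\<in>{\<G> \<in> ?L. \<G> \<subseteq> prefix_sets xs}. ?w \<G>)"
    by (rule sum.swap_restrict) (simp_all add: finite_l_chains)
  \<comment> \<open>Each inner sum is the weight sum of the full chain
    \<open>prefix_sets xs\<close>, hence one of the values under the maximum.\<close>
  also have "\<dots> \<le> (\<Sum>xs\<in>?P. max_chain_weight n l \<F>)"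
    unfolding max_chain_weight_def
    by (intro sum_mono Max_ge finite_imageI finite_full_chains imageI prefix_sets_full_chain)
  also have "\<dots> = max_chain_weight n l \<F> * fact n" by simp
  finally show ?thesis by simp
qed

theorem theorem5p4:
  fixes n l :: nat and D :: "nat set set \<Rightarrow> bool" and \<F> :: "nat set set"
  assumes "n \<ge> 1" and "l \<ge> 1"
    and "\<F> \<subseteq> Pow {1..n}" and "D \<F>"
  shows "card {\<G> \<in> l_chains n l. \<G> \<subseteq> \<F>} \<le> S_bound l n D"
proof -
  \<comment> \<open>\<open>Max\<close> bounds the members of a finite set; \<open>\<F>\<close>
    itself is one of the admissible families.\<close>
  have "finite {max_chain_weight n l \<F>' | \<F>'. \<F>' \<subseteq> Pow {1..n} \<and> D \<F>'}"
    by (rule finite_subset[of _ "max_chain_weight n l ` Pow (Pow {1..n})"]) auto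
  then have "max_chain_weight n l \<F> \<le> S_bound l n D"
    unfolding S_bound_def using assms(3,4) by (intro Max_ge) auto
  then show ?thesis using card_chains_le_max_chain_weight[OF assms(2)] order_trans by blast
qed

end
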